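(* Let $k$ be a commutative unital ring. On the category of quasi self-dual associative $k$-algebras (each equipped with its given isomorphism $\theta_A: H^*(A,A)\to H^*(A,A^{\vee\,\mathrm{op}})$ of graded $k$-modules), with $k$-algebra homomorphisms as morphisms, $H^*(A,A)$ is a contravariant functor of $A$ with values in graded $k$-modules. Here a morphism $\phi:B\to A$ induces the composite $$H^*(A,A)\xrightarrow{\ \theta_A\ } H^*(A,A^{\vee\,\mathrm{op}})\to H^*(B,A^{\vee\,\mathrm{op}})\to H^*(B,B^{\vee\,\mathrm{op}})\xrightarrow{\ \theta_B^{-1}\ }H^*(B,B),$$ where the second map is restriction along $\phi$ and the third is induced by the $B$-bimodule morphism $A^{\vee\,\mathrm{op}}\to B^{\vee\,\mathrm{op}}$, $f\mapsto f\circ\phi$.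
   Context: All algebras are free of finite rank as $k$-modules. $H^*(A,M)$ is the Hochschild cohomology over $k$ of $A$ with coefficients in the $A$-bimodule $M$, computed by the standard Hochschild cochain complex. $A^{\vee}=\operatorname{Hom}_k(A,k)$ is naturally an $A^{\mathrm{op}}$-bimodule, and $A^{\vee\,\mathrm{op}}$ is the same $k$-module with left and right operations interchanged, hence an $A$-bimodule; explicitly $(afb)(x)=f(bxa)$ for $a,b,x\in A$, $f\in A^\vee$. Via $\phi:B\to A$ every $A$-bimodule is regarded as a $B$-bimodule. An algebra $A$ is quasi self-dual if there is a canonical (i.e. specified) isomorphism of graded $k$-modules $\theta_A:H^*(A,A)\cong H^*(A,A^{\vee\,\mathrm{op}})$. *)

theory Defs
  imports "HOL-Algebra.Module" "HOL-Algebra.QuotRing"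
begin

section \<open>Categories and contravariant functors\<close>

record ('o, 'm) category =
  Obj :: "'o set"
  Arr :: "'o \<Rightarrow> 'o \<Rightarrow> 'm set"
  Ident :: "'o \<Rightarrow> 'm"
  Comp :: "'o \<Rightarrow> 'o \<Rightarrow> 'o \<Rightarrow> 'm \<Rightarrow> 'm \<Rightarrow> 'm"
    \<comment> \<open>\<open>Comp C X Y Z g f\<close> is the composite of \<open>f : X \<rightarrow> Y\<close> and \<open>g : Y \<rightarrow> Z\<close>\<close>

locale category =
  fixes C :: "('o, 'm) category"
  assumes Ident_closed: "X \<in> Obj C \<Longrightarrow> Ident C X \<in> Arr C X X"
    and Comp_closed:
      "\<lbrakk>X \<in> Obj C; Y \<in> Obj C; Z \<in> Obj C; f \<in> Arr C X Y; g \<in> Arr C Y Z\<rbrakk>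
        \<Longrightarrow> Comp C X Y Z g f \<in> Arr C X Z"
    and Comp_Ident_left:
      "\<lbrakk>X \<in> Obj C; Y \<in> Obj C; f \<in> Arr C X Y\<rbrakk> \<Longrightarrow> Comp C X Y Y (Ident C Y) f = f"
    and Comp_Ident_right:
      "\<lbrakk>X \<in> Obj C; Y \<in> Obj C; f \<in> Arr C X Y\<rbrakk> \<Longrightarrow> Comp C X X Y f (Ident C X) = f"
    and Comp_assoc:
      "\<lbrakk>W \<in> Obj C; X \<in> Obj C; Y \<in> Obj C; Z \<in> Obj C;
        f \<in> Arr C W X; g \<in> Arr C X Y; h \<in> Arr C Y Z\<rbrakk>
        \<Longrightarrow> Comp C W X Z (Comp C X Y Z h g) f = Comp C W Y Z h (Comp C W X Y g f)"

locale contravariant_functor =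
  C: category C + D: category D
  for C :: "('o, 'm) category" and D :: "('p, 'n) category" +
  fixes Fo :: "'o \<Rightarrow> 'p" and Fm :: "'o \<Rightarrow> 'o \<Rightarrow> 'm \<Rightarrow> 'n"
  assumes Fo_closed: "X \<in> Obj C \<Longrightarrow> Fo X \<in> Obj D"
    and Fm_closed:
      "\<lbrakk>X \<in> Obj C; Y \<in> Obj C; f \<in> Arr C X Y\<rbrakk> \<Longrightarrow> Fm X Y f \<in> Arr D (Fo Y) (Fo X)"
    and Fm_Ident: "X \<in> Obj C \<Longrightarrow> Fm X X (Ident C X) = Ident D (Fo X)"
    and Fm_Comp:
      "\<lbrakk>X \<in> Obj C; Y \<in> Obj C; Z \<in> Obj C; f \<in> Arr C X Y; g \<in> Arr C Y Z\<rbrakk>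
        \<Longrightarrow> Fm X Z (Comp C X Y Z g f)
            = Comp D (Fo Z) (Fo Y) (Fo X) (Fm X Y f) (Fm Y Z g)"


section \<open>Modules, graded modules and algebras\<close>

text \<open>Homomorphisms are extensional functions, so that they are equal as soon as
  they agree on the carrier.\<close>

definition module_homs ::
    "('k, 'r) ring_scheme \<Rightarrow> ('k, 'm, 's) module_scheme \<Rightarrow> ('k, 'n, 't) module_scheme \<Rightarrow> ('m \<Rightarrow> 'n) set"
  where "module_homs k M N =
    {f \<in> carrier M \<rightarrow>\<^sub>E carrier N.
      (\<forall>x\<in>carrier M. \<forall>y\<in>carrier M. f (x \<oplus>\<^bsub>M\<^esub> y) = f x \<oplus>\<^bsub>N\<^esub> f y) \<and>
      (\<forall>c\<in>carrier k. \<forall>x\<in>carrier M. f (c \<odot>\<^bsub>M\<^esub> x) = c \<odot>\<^bsub>N\<^esub> f x)}"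

definition graded_homs ::
    "('k, 'r) ring_scheme \<Rightarrow> (nat \<Rightarrow> ('k, 'm) module) \<Rightarrow> (nat \<Rightarrow> ('k, 'n) module) \<Rightarrow> (nat \<Rightarrow> 'm \<Rightarrow> 'n) set"
  where "graded_homs k M N = {f. \<forall>n. f n \<in> module_homs k (M n) (N n)}"

definition graded_isos ::
    "('k, 'r) ring_scheme \<Rightarrow> (nat \<Rightarrow> ('k, 'm) module) \<Rightarrow> (nat \<Rightarrow> ('k, 'n) module) \<Rightarrow> (nat \<Rightarrow> 'm \<Rightarrow> 'n) set"
  where "graded_isos k M N =
    {f \<in> graded_homs k M N. \<forall>n. bij_betw (f n) (carrier (M n)) (carrier (N n))}"

definition graded_module_category ::
    "('k, 'r) ring_scheme \<Rightarrow> (nat \<Rightarrow> ('k, 'm) module, nat \<Rightarrow> 'm \<Rightarrow> 'm) category"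
  where "graded_module_category k =
    \<lparr>Obj = {M. \<forall>n. module k (M n)},
     Arr = graded_homs k,
     Ident = (\<lambda>M n. \<lambda>x\<in>carrier (M n). x),
     Comp = (\<lambda>L M N g f n. compose (carrier (L n)) (g n) (f n))\<rparr>"

definition free_of_finite_rank :: "('k, 'r) ring_scheme \<Rightarrow> ('k, 'm, 's) module_scheme \<Rightarrow> bool"
  where "free_of_finite_rank k M \<longleftrightarrow>
    (\<exists>E. finite E \<and> E \<subseteq> carrier M \<and>
      (\<forall>x\<in>carrier M. \<exists>!c. c \<in> E \<rightarrow>\<^sub>E carrier k \<and> x = (\<Oplus>\<^bsub>M\<^esub>e\<in>E. c e \<odot>\<^bsub>M\<^esub> e)))"

text \<open>The locale \<^locale>\<open>algebra\<close> of the library is restricted to commutative algebras.\<close>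

locale associative_algebra = module k A + A?: ring A
  for k (structure) and A (structure) +
  assumes smult_mult_left:
      "\<lbrakk>c \<in> carrier k; x \<in> carrier A; y \<in> carrier A\<rbrakk>
        \<Longrightarrow> (c \<odot>\<^bsub>A\<^esub> x) \<otimes>\<^bsub>A\<^esub> y = c \<odot>\<^bsub>A\<^esub> (x \<otimes>\<^bsub>A\<^esub> y)"
    and smult_mult_right:
      "\<lbrakk>c \<in> carrier k; x \<in> carrier A; y \<in> carrier A\<rbrakk>
        \<Longrightarrow> x \<otimes>\<^bsub>A\<^esub> (c \<odot>\<^bsub>A\<^esub> y) = c \<odot>\<^bsub>A\<^esub> (x \<otimes>\<^bsub>A\<^esub> y)"

definition algebra_homs ::
    "('k, 'r) ring_scheme \<Rightarrow> ('k, 'a) module \<Rightarrow> ('k, 'b) module \<Rightarrow> ('a \<Rightarrow> 'b) set"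
  where "algebra_homs k A B = ring_hom A B \<inter> module_homs k A B"


section \<open>Bimodules\<close>

record ('k, 'm, 'a) bimodule = "('k, 'm) module" +
  lact :: "'a \<Rightarrow> 'm \<Rightarrow> 'm"
  ract :: "'m \<Rightarrow> 'a \<Rightarrow> 'm"

text \<open>A \<^const>\<open>module\<close> record is a ring record; its fields \<^const>\<open>mult\<close> and \<^const>\<open>one\<close>
  play no role for modules and are left \<^const>\<open>undefined\<close>.\<close>

definition regular_bimodule :: "('k, 'a) module \<Rightarrow> ('k, 'a, 'a) bimodule"
  where "regular_bimodule A =
    \<lparr>carrier = carrier A, mult = undefined, one = undefined,
     zero = \<zero>\<^bsub>A\<^esub>, add = (\<oplus>\<^bsub>A\<^esub>), smult = (\<odot>\<^bsub>A\<^esub>), lact = (\<otimes>\<^bsub>A\<^esub>), ract = (\<otimes>\<^bsub>A\<^esub>)\<rparr>"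

definition dual_carrier :: "('k, 'r) ring_scheme \<Rightarrow> ('k, 'a) module \<Rightarrow> ('a \<Rightarrow> 'k) set"
  where "dual_carrier k A =
    {f \<in> carrier A \<rightarrow>\<^sub>E carrier k.
      (\<forall>x\<in>carrier A. \<forall>y\<in>carrier A. f (x \<oplus>\<^bsub>A\<^esub> y) = f x \<oplus>\<^bsub>k\<^esub> f y) \<and>
      (\<forall>c\<in>carrier k. \<forall>x\<in>carrier A. f (c \<odot>\<^bsub>A\<^esub> x) = c \<otimes>\<^bsub>k\<^esub> f x)}"

text \<open>The \<open>A\<close>-bimodule \<open>A\<^sup>\<or>\<^sup>o\<^sup>p\<close>: \<open>(a f b)(x) = f (b x a)\<close>.\<close>

definition dual_op_bimodule ::
    "('k, 'r) ring_scheme \<Rightarrow> ('k, 'a) module \<Rightarrow> ('k, 'a \<Rightarrow> 'k, 'a) bimodule"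
  where "dual_op_bimodule k A =
    \<lparr>carrier = dual_carrier k A, mult = undefined, one = undefined,
     zero = (\<lambda>x\<in>carrier A. \<zero>\<^bsub>k\<^esub>),
     add = (\<lambda>f g. \<lambda>x\<in>carrier A. f x \<oplus>\<^bsub>k\<^esub> g x),
     smult = (\<lambda>c f. \<lambda>x\<in>carrier A. c \<otimes>\<^bsub>k\<^esub> f x),
     lact = (\<lambda>a f. \<lambda>x\<in>carrier A. f (x \<otimes>\<^bsub>A\<^esub> a)),
     ract = (\<lambda>f b. \<lambda>x\<in>carrier A. f (b \<otimes>\<^bsub>A\<^esub> x))\<rparr>"

definition restrict_bimodule :: "('b \<Rightarrow> 'a) \<Rightarrow> ('k, 'm, 'a) bimodule \<Rightarrow> ('k, 'm, 'b) bimodule"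
  where "restrict_bimodule \<phi> M =
    \<lparr>carrier = carrier M, mult = undefined, one = undefined,
     zero = \<zero>\<^bsub>M\<^esub>, add = (\<oplus>\<^bsub>M\<^esub>), smult = (\<odot>\<^bsub>M\<^esub>),
     lact = (\<lambda>b. lact M (\<phi> b)), ract = (\<lambda>m b. ract M m (\<phi> b))\<rparr>"


section \<open>Hochschild cohomology\<close>

definition tuples :: "('a, 's) partial_object_scheme \<Rightarrow> nat \<Rightarrow> 'a list set"
  where "tuples A n = {xs. length xs = n \<and> set xs \<subseteq> carrier A}"

definition cochain_carrier ::
    "('k, 'r) ring_scheme \<Rightarrow> ('k, 'a) module \<Rightarrow> ('k, 'm, 'a) bimodule \<Rightarrow> nat \<Rightarrow> ('a list \<Rightarrow> 'm) set"
  where "cochain_carrier k A M n =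
    {f \<in> tuples A n \<rightarrow>\<^sub>E carrier M. \<forall>xs\<in>tuples A n. \<forall>i<n.
      (\<forall>x\<in>carrier A. \<forall>y\<in>carrier A.
        f (xs[i := x \<oplus>\<^bsub>A\<^esub> y]) = f (xs[i := x]) \<oplus>\<^bsub>M\<^esub> f (xs[i := y])) \<and>
      (\<forall>c\<in>carrier k. \<forall>x\<in>carrier A.
        f (xs[i := c \<odot>\<^bsub>A\<^esub> x]) = c \<odot>\<^bsub>M\<^esub> f (xs[i := x]))}"

definition cochains ::
    "('k, 'r) ring_scheme \<Rightarrow> ('k, 'a) module \<Rightarrow> ('k, 'm, 'a) bimodule \<Rightarrow> nat \<Rightarrow> ('k, 'a list \<Rightarrow> 'm) module"
  where "cochains k A M n =
    \<lparr>carrier = cochain_carrier k A M n, mult = undefined, one = undefined,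
     zero = (\<lambda>xs\<in>tuples A n. \<zero>\<^bsub>M\<^esub>),
     add = (\<lambda>f g. \<lambda>xs\<in>tuples A n. f xs \<oplus>\<^bsub>M\<^esub> g xs),
     smult = (\<lambda>c f. \<lambda>xs\<in>tuples A n. c \<odot>\<^bsub>M\<^esub> f xs)\<rparr>"

definition coboundary ::
    "('k, 'a) module \<Rightarrow> ('k, 'm, 'a) bimodule \<Rightarrow> nat \<Rightarrow> ('a list \<Rightarrow> 'm) \<Rightarrow> 'a list \<Rightarrow> 'm"
  where "coboundary A M n f = (\<lambda>xs\<in>tuples A (Suc n).
     lact M (hd xs) (f (tl xs)) \<oplus>\<^bsub>M\<^esub>
     (\<Oplus>\<^bsub>M\<^esub>i\<in>{..<n}. [((-1) ^ Suc i :: int)] \<cdot>\<^bsub>M\<^esub>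
        f (take i xs @ (xs ! i \<otimes>\<^bsub>A\<^esub> xs ! Suc i) # drop (Suc (Suc i)) xs)) \<oplus>\<^bsub>M\<^esub>
     [((-1) ^ Suc n :: int)] \<cdot>\<^bsub>M\<^esub> ract M (f (butlast xs)) (last xs))"

definition cocycles ::
    "('k, 'r) ring_scheme \<Rightarrow> ('k, 'a) module \<Rightarrow> ('k, 'm, 'a) bimodule \<Rightarrow> nat \<Rightarrow> ('a list \<Rightarrow> 'm) set"
  where "cocycles k A M n =
    {f \<in> carrier (cochains k A M n). coboundary A M n f = \<zero>\<^bsub>cochains k A M (Suc n)\<^esub>}"

fun coboundaries ::
    "('k, 'r) ring_scheme \<Rightarrow> ('k, 'a) module \<Rightarrow> ('k, 'm, 'a) bimodule \<Rightarrow> nat \<Rightarrow> ('a list \<Rightarrow> 'm) set"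
  where
    "coboundaries k A M 0 = {\<zero>\<^bsub>cochains k A M 0\<^esub>}"
  | "coboundaries k A M (Suc n) = coboundary A M n ` carrier (cochains k A M n)"

definition cohomology_class ::
    "('k, 'r) ring_scheme \<Rightarrow> ('k, 'a) module \<Rightarrow> ('k, 'm, 'a) bimodule \<Rightarrow> nat \<Rightarrow>
      ('a list \<Rightarrow> 'm) \<Rightarrow> ('a list \<Rightarrow> 'm) set"
  where "cohomology_class k A M n z = coboundaries k A M n +>\<^bsub>cochains k A M n\<^esub> z"

text \<open>In \<^const>\<open>smult\<close> the union is over representatives of one and the same class, as in
  \<^const>\<open>rcoset_mult\<close>; likewise in \<open>cohomology_map\<close> below.\<close>

definition hochschild ::
    "('k, 'r) ring_scheme \<Rightarrow> ('k, 'a) module \<Rightarrow> ('k, 'm, 'a) bimodule \<Rightarrow> nat \<Rightarrow>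
      ('k, ('a list \<Rightarrow> 'm) set) module"
  where "hochschild k A M n =
    \<lparr>carrier = cohomology_class k A M n ` cocycles k A M n, mult = undefined, one = undefined,
     zero = coboundaries k A M n,
     add = set_add (cochains k A M n),
     smult = (\<lambda>c X. \<Union>z\<in>X. cohomology_class k A M n (c \<odot>\<^bsub>cochains k A M n\<^esub> z))\<rparr>"

text \<open>The map \<open>H\<^sup>n(A,M) \<rightarrow> H\<^sup>n(B,N)\<close> induced by a map \<open>F\<close> on \<open>n\<close>-cochains.\<close>

definition cohomology_map ::
    "('k, 'r) ring_scheme \<Rightarrow> ('k, 'a) module \<Rightarrow> ('k, 'm, 'a) bimodule \<Rightarrow>
      ('k, 'b) module \<Rightarrow> ('k, 'n, 'b) bimodule \<Rightarrow> nat \<Rightarrow>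
      (('a list \<Rightarrow> 'm) \<Rightarrow> ('b list \<Rightarrow> 'n)) \<Rightarrow> ('a list \<Rightarrow> 'm) set \<Rightarrow> ('b list \<Rightarrow> 'n) set"
  where "cohomology_map k A M B N n F =
    (\<lambda>X\<in>carrier (hochschild k A M n). \<Union>z\<in>X. cohomology_class k B N n (F z))"

definition restriction_map ::
    "('k, 'r) ring_scheme \<Rightarrow> ('k, 'a) module \<Rightarrow> ('k, 'b) module \<Rightarrow> ('b \<Rightarrow> 'a) \<Rightarrow>
      ('k, 'm, 'a) bimodule \<Rightarrow> nat \<Rightarrow> ('a list \<Rightarrow> 'm) set \<Rightarrow> ('b list \<Rightarrow> 'm) set"
  where "restriction_map k A B \<phi> M n =
    cohomology_map k A M B (restrict_bimodule \<phi> M) n (\<lambda>f. \<lambda>xs\<in>tuples B n. f (map \<phi> xs))"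

definition coefficient_map ::
    "('k, 'r) ring_scheme \<Rightarrow> ('k, 'b) module \<Rightarrow> ('k, 'm, 'b) bimodule \<Rightarrow> ('k, 'n, 'b) bimodule \<Rightarrow>
      ('m \<Rightarrow> 'n) \<Rightarrow> nat \<Rightarrow> ('b list \<Rightarrow> 'm) set \<Rightarrow> ('b list \<Rightarrow> 'n) set"
  where "coefficient_map k B M N h n =
    cohomology_map k B M B N n (\<lambda>f. \<lambda>xs\<in>tuples B n. h (f xs))"

definition dual_map :: "('k, 'b) module \<Rightarrow> ('b \<Rightarrow> 'a) \<Rightarrow> ('a \<Rightarrow> 'k) \<Rightarrow> ('b \<Rightarrow> 'k)"
  where "dual_map B \<phi> f = (\<lambda>x\<in>carrier B. f (\<phi> x))"


section \<open>Quasi self-dual algebras\<close>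

type_synonym ('k, 'a) self_duality =
  "nat \<Rightarrow> ('a list \<Rightarrow> 'a) set \<Rightarrow> ('a list \<Rightarrow> 'a \<Rightarrow> 'k) set"

definition quasi_self_dual ::
    "('k, 'r) ring_scheme \<Rightarrow> ('k, 'a) module \<Rightarrow> ('k, 'a) self_duality \<Rightarrow> bool"
  where "quasi_self_dual k A \<theta> \<longleftrightarrow>
    associative_algebra k A \<and> free_of_finite_rank k A \<and>
    \<theta> \<in> graded_isos k (hochschild k A (regular_bimodule A)) (hochschild k A (dual_op_bimodule k A))"

definition quasi_self_dual_category ::
    "('k, 'r) ring_scheme \<Rightarrow> (('k, 'a) module \<times> ('k, 'a) self_duality, 'a \<Rightarrow> 'a) category"
  where "quasi_self_dual_category k =
    \<lparr>Obj = {(A, \<theta>). quasi_self_dual k A \<theta>},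
     Arr = (\<lambda>(B, _) (A, _). algebra_homs k B A),
     Ident = (\<lambda>(A, _). \<lambda>x\<in>carrier A. x),
     Comp = (\<lambda>(C, _) _ _ g f. compose (carrier C) g f)\<rparr>"

definition self_cohomology ::
    "('k, 'r) ring_scheme \<Rightarrow> ('k, 'a) module \<times> ('k, 'a) self_duality \<Rightarrow>
      nat \<Rightarrow> ('k, ('a list \<Rightarrow> 'a) set) module"
  where "self_cohomology k = (\<lambda>(A, _). hochschild k A (regular_bimodule A))"

text \<open>The map \<open>H\<^sup>*(A,A) \<rightarrow> H\<^sup>*(B,B)\<close> induced by \<open>\<phi> : B \<rightarrow> A\<close>.\<close>

definition self_cohomology_map ::
    "('k, 'r) ring_scheme \<Rightarrow> ('k, 'b) module \<times> ('k, 'b) self_duality \<Rightarrow>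
      ('k, 'a) module \<times> ('k, 'a) self_duality \<Rightarrow> ('b \<Rightarrow> 'a) \<Rightarrow>
      nat \<Rightarrow> ('a list \<Rightarrow> 'a) set \<Rightarrow> ('b list \<Rightarrow> 'b) set"
  where "self_cohomology_map k = (\<lambda>(B, \<theta>\<^sub>B) (A, \<theta>\<^sub>A) \<phi> n.
    \<lambda>X\<in>carrier (hochschild k A (regular_bimodule A) n).
      inv_into (carrier (hochschild k B (regular_bimodule B) n)) (\<theta>\<^sub>B n)
        (coefficient_map k B (restrict_bimodule \<phi> (dual_op_bimodule k A)) (dual_op_bimodule k B)
            (dual_map B \<phi>) n
          (restriction_map k A B \<phi> (dual_op_bimodule k A) n
            (\<theta>\<^sub>A n X))))"

end

theory Submission
  imports Defs
begin

text \<open>A morphism \<open>\<phi> : B \<rightarrow> A\<close> acts on cochains with dual coefficients by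
  \<open>z \<mapsto> \<phi>\<^sup>\<or> \<circ> z \<circ> \<phi>\<^sup>n\<close>. This commutes with the Hochschild differential and is
  contravariantly functorial already on cochains, so \<open>A \<mapsto> H\<^sup>*(A, A\<^sup>\<or>\<^sup>o\<^sup>p)\<close> is a functor;
  conjugating by the isomorphisms \<open>\<theta>\<close> transports it to \<open>H\<^sup>*(A, A)\<close>.\<close>

section \<open>Linear maps and submodules\<close>

text \<open>Hochschild cohomology is contravariant in the algebra but covariant in the coefficients,
  so for \<phi> from \<open>B\<close> to \<open>A\<close> the groups \<open>H(A,A)\<close> and
  \<open>H(B,B)\<close> both map to \<open>H(B,A)\<close> and no map between them results. Dualizing
  the coefficients reverses the second variance, and both dependences then point from
  \<open>A\<close> to \<open>B\<close>. The isomorphisms \<theta> carry this back to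
  \<open>H(A,A)\<close>: in a composite of two induced maps, the inverse of \<theta> for the middle
  algebra meets \<theta> itself and cancels, so functoriality asks of each \<theta> only that it be
  bijective. Maps are compared as extensional functions. The two functor laws for dual coefficients
  hold as equalities of cochains, hence of classes, once every function involved is known to be
  restricted to its carrier and every argument to lie in that carrier.\<close>

lemma module_cong:
  fixes M :: "('k, 'm, 's) module_scheme" and N :: "('k, 'm, 't) module_scheme"
  assumes "module k M"
    and eqs: "carrier N = carrier M" "zero N = zero M" "add N = add M" "smult N = smult M"
  shows "module k N"
proof -
  interpret M: module k M by fact
  show ?thesis
    using M.R.cring_axioms M.l_neg
    by (intro moduleI abelian_groupI)
      (auto simp: eqs M.a_assoc M.smult_l_distr M.smult_r_distr M.smult_assoc1 intro: M.a_comm)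
qed

text \<open>The ring \<open>k\<close> as a module over itself. A ring record has no scalar
  multiplication field, so a separate record is built; it is the target in which linear functionals
  take their values.\<close>

definition scalar_module :: "('k, 'r) ring_scheme \<Rightarrow> ('k, 'k) module"
  where "scalar_module k =
    \<lparr>carrier = carrier k, mult = undefined, one = undefined,
     zero = \<zero>\<^bsub>k\<^esub>, add = (\<oplus>\<^bsub>k\<^esub>), smult = (\<otimes>\<^bsub>k\<^esub>)\<rparr>"

lemma module_scalar_module:
  assumes "cring k"
  shows "module k (scalar_module k)"
proof -
  interpret cring k by fact
  show ?thesis
    unfolding scalar_module_def
    using l_neg by (intro moduleI abelian_groupI cring_axioms) (auto simp: a_ac l_distr r_distr m_assoc)
qed

lemmas PiE_const_mem = PiE_mem[where T = "\<lambda>_. B" for B]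

text \<open>A common ambient module: cochains, cocycles, coboundaries and the dual of an algebra are
  all submodules of such modules, so the module axioms for functions are verified only once.\<close>

definition function_module :: "'i set \<Rightarrow> ('k, 'm, 's) module_scheme \<Rightarrow> ('k, 'i \<Rightarrow> 'm) module"
  where "function_module I M =
    \<lparr>carrier = I \<rightarrow>\<^sub>E carrier M, mult = undefined, one = undefined,
     zero = (\<lambda>i\<in>I. \<zero>\<^bsub>M\<^esub>),
     add = (\<lambda>f g. \<lambda>i\<in>I. f i \<oplus>\<^bsub>M\<^esub> g i),
     smult = (\<lambda>c f. \<lambda>i\<in>I. c \<odot>\<^bsub>M\<^esub> f i)\<rparr>"

lemma function_module_simps [simp]:
  "carrier (function_module I M) = (I \<rightarrow>\<^sub>E carrier M)"
  "\<zero>\<^bsub>function_module I M\<^esub> = (\<lambda>i\<in>I. \<zero>\<^bsub>M\<^esub>)"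
  "f \<oplus>\<^bsub>function_module I M\<^esub> g = (\<lambda>i\<in>I. f i \<oplus>\<^bsub>M\<^esub> g i)"
  "c \<odot>\<^bsub>function_module I M\<^esub> f = (\<lambda>i\<in>I. c \<odot>\<^bsub>M\<^esub> f i)"
  by (simp_all add: function_module_def)

lemma module_function_module:
  assumes "module k M"
  shows "module k (function_module I M)"
proof -
  interpret M: module k M by fact
  have neg: "\<exists>g\<in>I \<rightarrow>\<^sub>E carrier M. (\<lambda>i\<in>I. g i \<oplus>\<^bsub>M\<^esub> f i) = (\<lambda>i\<in>I. \<zero>\<^bsub>M\<^esub>)"
    if "f \<in> I \<rightarrow>\<^sub>E carrier M" for f
    using that by (intro bexI[of _ "\<lambda>i\<in>I. \<ominus>\<^bsub>M\<^esub> f i"]) (auto simp: M.l_neg PiE_const_mem intro!: restrict_ext)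
  show ?thesis
    by (intro moduleI abelian_groupI M.R.cring_axioms)
      (auto simp: PiE_iff neg[unfolded PiE_iff] M.a_ac M.smult_l_distr M.smult_r_distr M.smult_assoc1
        intro!: restrict_ext extensionalityI[of _ I])
qed

lemma (in module) submodule_of_closed:
  assumes "H \<subseteq> carrier M" and "\<zero>\<^bsub>M\<^esub> \<in> H"
    and "\<And>x y. x \<in> H \<Longrightarrow> y \<in> H \<Longrightarrow> x \<oplus>\<^bsub>M\<^esub> y \<in> H"
    and smult: "\<And>c x. c \<in> carrier R \<Longrightarrow> x \<in> H \<Longrightarrow> c \<odot>\<^bsub>M\<^esub> x \<in> H"
  shows "submodule H R M"
proof (intro submoduleI assms)
  fix x assume "x \<in> H"
  then show "\<ominus>\<^bsub>M\<^esub> x \<in> H"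
    \<comment> \<open>Negation is multiplication by the scalar \<open>\<ominus> \<one>\<close>, so
      closure under scalars already gives closure under negatives.\<close>
    using smult[of "\<ominus> \<one>" x] \<open>H \<subseteq> carrier M\<close> by (auto simp: smult_l_minus subset_iff)
qed

text \<open>In contrast to \<open>module_homs\<close>, extensionality is not demanded, so that
  unrestricted operations such as \<open>lact M a\<close> or multiplication by a scalar are
  instances.\<close>

locale linear_map = M: module k M + N: module k N
  for k :: "('k, 'r) ring_scheme" and M :: "('k, 'm, 's) module_scheme"
    and N :: "('k, 'n, 't) module_scheme" and h :: "'m \<Rightarrow> 'n" +
  assumes map_closed: "x \<in> carrier M \<Longrightarrow> h x \<in> carrier N"
    and map_add: "\<lbrakk>x \<in> carrier M; y \<in> carrier M\<rbrakk> \<Longrightarrow> h (x \<oplus>\<^bsub>M\<^esub> y) = h x \<oplus>\<^bsub>N\<^esub> h y"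
    and map_smult: "\<lbrakk>c \<in> carrier k; x \<in> carrier M\<rbrakk> \<Longrightarrow> h (c \<odot>\<^bsub>M\<^esub> x) = c \<odot>\<^bsub>N\<^esub> h x"
begin

lemma map_hom: "h \<in> hom (add_monoid M) (add_monoid N)"
  by (auto simp: hom_def map_closed map_add)

lemma map_zero: "h \<zero>\<^bsub>M\<^esub> = \<zero>\<^bsub>N\<^esub>"
  using hom_one[OF map_hom M.add.is_group N.add.is_group] by simp

lemma map_add_pow: "x \<in> carrier M \<Longrightarrow> h ([(z::int)] \<cdot>\<^bsub>M\<^esub> x) = [z] \<cdot>\<^bsub>N\<^esub> h x"
  using hom_int_pow[OF map_hom _ M.add.is_group N.add.is_group] by (simp add: add_pow_def)

lemma map_finsum:
  "f \<in> I \<rightarrow> carrier M \<Longrightarrow> h (\<Oplus>\<^bsub>M\<^esub>i\<in>I. f i) = (\<Oplus>\<^bsub>N\<^esub>i\<in>I. h (f i))"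
  by (induction I rule: infinite_finite_induct) (auto simp: map_zero map_add map_closed Pi_def)

lemma submodule_image:
  assumes "submodule S k M"
  shows "submodule (h ` S) k N"
  using M.submoduleE[OF assms] subgroup.one_closed[OF submodule.axioms(1)[OF assms]]
  by (intro N.submodule_of_closed)
    (auto simp: map_closed map_zero[symmetric] subset_iff simp flip: map_add map_smult)

lemma submodule_kernel: "submodule {x \<in> carrier M. h x = \<zero>\<^bsub>N\<^esub>} k M"
  by (intro M.submodule_of_closed) (auto simp: map_zero map_add map_smult)

end

lemma (in module) submodule_Int:
  assumes "submodule H R M" "submodule K R M"
  shows "submodule (H \<inter> K) R M"
  using submoduleE[OF assms(1)] submoduleE[OF assms(2)]
    submodule.axioms(1)[OF assms(1)] submodule.axioms(1)[OF assms(2)]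
  by (intro submodule_of_closed) (auto dest: subgroup.one_closed)

lemma (in module) submodule_zero: "submodule {\<zero>\<^bsub>M\<^esub>} R M"
  by (intro submodule_of_closed) auto

text \<open>Commutativity of the scalars makes multiplication by \<open>c\<close> linear. It can
  then be moved through finite sums, and the scalar action on a quotient becomes a special case of
  an induced map.\<close>

lemma (in module) linear_map_smult:
  "c \<in> carrier R \<Longrightarrow> linear_map R M M (\<lambda>x. c \<odot>\<^bsub>M\<^esub> x)"
  by unfold_locales (simp_all add: smult_r_distr flip: smult_assoc1, simp add: R.m_comm)

lemma module_homs_restrict:
  "linear_map k M N h \<Longrightarrow> (\<lambda>x\<in>carrier M. h x) \<in> module_homs k M N"
  unfolding module_homs_def
  by (auto simp: linear_map.map_closed linear_map.map_add linear_map.map_smult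
      linear_map_def module.smult_closed abelian_groupE(1) module.axioms(2))

lemma module_homs_closed: "h \<in> module_homs k M N \<Longrightarrow> x \<in> carrier M \<Longrightarrow> h x \<in> carrier N"
  by (auto simp: module_homs_def)

lemma module_homs_id:
  assumes "module k M"
  shows "(\<lambda>x\<in>carrier M. x) \<in> module_homs k M M"
proof -
  interpret M: module k M by fact
  show ?thesis
    by (auto simp: module_homs_def)
qed

lemma module_homs_compose:
  assumes "f \<in> module_homs k L M" "g \<in> module_homs k M N" "module k L"
  shows "compose (carrier L) g f \<in> module_homs k L N"
proof -
  interpret L: module k L by fact
  show ?thesis
    using assms(1,2) by (auto simp: module_homs_def compose_def PiE_const_mem)
qed

lemma module_homs_inv_into:
  assumes f: "f \<in> module_homs k M N" and bij: "bij_betw f (carrier M) (carrier N)"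
    and M: "module k M"
  shows "(\<lambda>y\<in>carrier N. inv_into (carrier M) f y) \<in> module_homs k N M"
proof -
  interpret M: module k M by fact
  let ?g = "inv_into (carrier M) f"
  have g: "?g y \<in> carrier M" "f (?g y) = y" if "y \<in> carrier N" for y
    using that bij by (auto simp: bij_betw_def inv_into_into f_inv_into_f)
  have add: "?g (x \<oplus>\<^bsub>N\<^esub> y) = ?g x \<oplus>\<^bsub>M\<^esub> ?g y" if "x \<in> carrier N" "y \<in> carrier N" for x y
  proof (rule inv_into_f_eq)
    show "f (?g x \<oplus>\<^bsub>M\<^esub> ?g y) = x \<oplus>\<^bsub>N\<^esub> y"
      using f g that by (simp add: module_homs_def)
  qed (use g that bij in \<open>auto simp: bij_betw_def\<close>)
  have smult: "?g (c \<odot>\<^bsub>N\<^esub> x) = c \<odot>\<^bsub>M\<^esub> ?g x" if "c \<in> carrier k" "x \<in> carrier N" for c x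
  proof (rule inv_into_f_eq)
    show "f (c \<odot>\<^bsub>M\<^esub> ?g x) = c \<odot>\<^bsub>N\<^esub> x"
      using f g that by (simp add: module_homs_def)
  qed (use g that bij in \<open>auto simp: bij_betw_def\<close>)
  \<comment> \<open>Closure of \<open>carrier N\<close> is transported along the bijection: a sum in
    \<open>N\<close> is the image under \<open>f\<close> of a sum in \<open>M\<close>.\<close>
  have "x \<oplus>\<^bsub>N\<^esub> y \<in> carrier N" if "x \<in> carrier N" "y \<in> carrier N" for x y
  proof -
    have "f (?g x \<oplus>\<^bsub>M\<^esub> ?g y) = x \<oplus>\<^bsub>N\<^esub> y" "f \<in> carrier M \<rightarrow> carrier N"
      using f g that by (auto simp: module_homs_def)
    then show ?thesis
      using g that by (metis M.a_closed Pi_mem)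
  qed
  moreover have "c \<odot>\<^bsub>N\<^esub> x \<in> carrier N" if "c \<in> carrier k" "x \<in> carrier N" for c x
  proof -
    have "f (c \<odot>\<^bsub>M\<^esub> ?g x) = c \<odot>\<^bsub>N\<^esub> x" "f \<in> carrier M \<rightarrow> carrier N"
      using f g that by (auto simp: module_homs_def)
    then show ?thesis
      using g that by (metis M.smult_closed Pi_mem)
  qed
  ultimately show ?thesis
    using g add smult by (auto simp: module_homs_def)
qed

section \<open>Subquotients\<close>

text \<open>The image of \<open>Z\<close> in \<open>P / B\<close>; it is a module whether or not \<open>B \<subseteq> Z\<close>.\<close>

definition subquotient ::
    "('k, 'p, 's) module_scheme \<Rightarrow> 'p set \<Rightarrow> 'p set \<Rightarrow> ('k, 'p set) module"
  where "subquotient P Z B =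
    \<lparr>carrier = (\<lambda>z. B +>\<^bsub>P\<^esub> z) ` Z, mult = undefined, one = undefined,
     zero = B, add = set_add P,
     smult = (\<lambda>c X. \<Union>z\<in>X. B +>\<^bsub>P\<^esub> (c \<odot>\<^bsub>P\<^esub> z))\<rparr>"

lemma (in module) abelian_subgroup_submodule: "submodule H R M \<Longrightarrow> abelian_subgroup H M"
  by (intro abelian_subgroupI3 additive_subgroupI M.abelian_group_axioms submodule.axioms(1))

text \<open>Well-definedness on cosets: two representatives differ by an element of
  \<open>B\<close>, whose image lies in \<open>B'\<close>, so all members of the union are one and
  the same coset. This evaluates both induced maps and scalar multiplication on a quotient.\<close>

lemma (in linear_map) UN_coset_eq:
  assumes B: "submodule B k M" and B': "submodule B' k N" and "h ` B \<subseteq> B'" and z: "z \<in> carrier M"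
  shows "(\<Union>x\<in>B +>\<^bsub>M\<^esub> z. B' +>\<^bsub>N\<^esub> h x) = B' +>\<^bsub>N\<^esub> h z"
proof -
  have "B' +>\<^bsub>N\<^esub> h x = B' +>\<^bsub>N\<^esub> h z" if x: "x \<in> B +>\<^bsub>M\<^esub> z" for x
  proof -
    obtain b where b: "b \<in> B" "x = b \<oplus>\<^bsub>M\<^esub> z"
      using x by (auto simp: a_r_coset_def')
    have "b \<in> carrier M"
      using b M.submoduleE(1)[OF B] by auto
    then have "h x \<in> B' +>\<^bsub>N\<^esub> h z"
      using b z \<open>h ` B \<subseteq> B'\<close> by (auto simp: a_r_coset_def' map_add)
    from N.a_repr_independence[OF this _ submodule.axioms(1)[OF B']] z show ?thesis
      by (simp add: map_closed)
  qed
  \<comment> \<open>A union of equal sets is that set only if the index set is inhabited.\<close>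
  moreover have "B +>\<^bsub>M\<^esub> z \<noteq> {}"
    using M.submoduleE(2)[OF B] by (auto simp: a_r_coset_def')
  ultimately show ?thesis
    by auto
qed

lemma (in module) subquotient_simps:
  assumes B: "submodule B R M"
  shows "z \<in> carrier M \<Longrightarrow> w \<in> carrier M \<Longrightarrow>
      (B +>\<^bsub>M\<^esub> z) \<oplus>\<^bsub>subquotient M Z B\<^esub> (B +>\<^bsub>M\<^esub> w) = B +>\<^bsub>M\<^esub> (z \<oplus>\<^bsub>M\<^esub> w)"
    and "c \<in> carrier R \<Longrightarrow> z \<in> carrier M \<Longrightarrow>
      c \<odot>\<^bsub>subquotient M Z B\<^esub> (B +>\<^bsub>M\<^esub> z) = B +>\<^bsub>M\<^esub> (c \<odot>\<^bsub>M\<^esub> z)"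
    and "\<zero>\<^bsub>subquotient M Z B\<^esub> = B +>\<^bsub>M\<^esub> \<zero>\<^bsub>M\<^esub>"
proof -
  show "c \<odot>\<^bsub>subquotient M Z B\<^esub> (B +>\<^bsub>M\<^esub> z) = B +>\<^bsub>M\<^esub> (c \<odot>\<^bsub>M\<^esub> z)"
    if "c \<in> carrier R" "z \<in> carrier M"
    \<comment> \<open>The union that defines scalar multiplication is the induced map of the
      endomorphism given by \<open>c\<close>, which sends \<open>B\<close> into itself.\<close>
    using linear_map.UN_coset_eq[OF linear_map_smult B B] submoduleE(4)[OF B] that
    by (simp add: subquotient_def image_subset_iff)
qed (use abelian_subgroup.a_rcos_sum[OF abelian_subgroup_submodule[OF B]] submoduleE(1)[OF B]
    in \<open>simp_all add: subquotient_def\<close>)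

lemma (in module) module_subquotient:
  assumes Z: "submodule Z R M" and B: "submodule B R M"
  shows "module R (subquotient M Z B)"
proof -
  note Z' = submoduleE[OF Z]
  have zero: "\<zero>\<^bsub>M\<^esub> \<in> Z"
    using subgroup.one_closed[OF submodule.axioms(1)[OF Z]] by simp
  have carrier: "carrier (subquotient M Z B) = (\<lambda>z. B +>\<^bsub>M\<^esub> z) ` Z"
    by (simp add: subquotient_def)
  note simps = carrier subquotient_simps[OF B] subsetD[OF Z'(1)] Z'(4,5)
  have neg: "\<exists>Y\<in>carrier (subquotient M Z B). Y \<oplus>\<^bsub>subquotient M Z B\<^esub> X = \<zero>\<^bsub>subquotient M Z B\<^esub>"
    if X: "X \<in> carrier (subquotient M Z B)" for X
  proof -
    obtain z where z: "z \<in> Z" "X = B +>\<^bsub>M\<^esub> z"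
      using X by (auto simp: carrier)
    then show ?thesis
      by (intro bexI[of _ "B +>\<^bsub>M\<^esub> (\<ominus>\<^bsub>M\<^esub> z)"]) (auto simp: simps Z'(3) M.l_neg)
  qed
  show ?thesis
    by (intro moduleI abelian_groupI R.cring_axioms neg)
      (auto simp: simps zero M.a_assoc smult_l_distr smult_r_distr smult_assoc1
        simp: M.a_ac)
qed

text \<open>The map has the shape of \<open>cohomology_map\<close>, so that unfolding turns the
  latter into an instance.\<close>

lemma (in linear_map) subquotient_map:
  assumes Z: "submodule Z k M" and B: "submodule B k M" and Z': "submodule Z' k N" and B': "submodule B' k N"
    and ZZ: "h ` Z \<subseteq> Z'" and BB: "h ` B \<subseteq> B'"
  shows "(\<lambda>X\<in>carrier (subquotient M Z B). \<Union>z\<in>X. B' +>\<^bsub>N\<^esub> h z)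
    \<in> module_homs k (subquotient M Z B) (subquotient N Z' B')"
proof (intro module_homs_restrict)
  have Zc: "z \<in> carrier M" if "z \<in> Z" for z
    using M.submoduleE(1)[OF Z] that by auto
  have carrier: "carrier (subquotient M Z B) = (\<lambda>z. B +>\<^bsub>M\<^esub> z) ` Z"
    "carrier (subquotient N Z' B') = (\<lambda>z. B' +>\<^bsub>N\<^esub> z) ` Z'"
    by (simp_all add: subquotient_def)
  let ?Q = "subquotient M Z B" and ?Q' = "subquotient N Z' B'" and ?h = "\<lambda>X. \<Union>z\<in>X. B' +>\<^bsub>N\<^esub> h z"
  note coset = M.subquotient_simps[OF B] N.subquotient_simps[OF B'] UN_coset_eq[OF B B' BB]
  have "?h (X \<oplus>\<^bsub>?Q\<^esub> Y) = ?h X \<oplus>\<^bsub>?Q'\<^esub> ?h Y" if "X \<in> carrier ?Q" "Y \<in> carrier ?Q" for X Y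
  proof -
    obtain z w where "z \<in> carrier M" "X = B +>\<^bsub>M\<^esub> z" "w \<in> carrier M" "Y = B +>\<^bsub>M\<^esub> w"
      using \<open>X \<in> carrier ?Q\<close> \<open>Y \<in> carrier ?Q\<close> Zc unfolding carrier by blast
    then show ?thesis
      by (simp only: coset M.a_closed map_closed map_add)
  qed
  moreover have "?h (c \<odot>\<^bsub>?Q\<^esub> X) = c \<odot>\<^bsub>?Q'\<^esub> ?h X" if "c \<in> carrier k" "X \<in> carrier ?Q" for c X
  proof -
    obtain z where "z \<in> carrier M" "X = B +>\<^bsub>M\<^esub> z"
      using \<open>X \<in> carrier ?Q\<close> Zc unfolding carrier by blast
    then show ?thesis
      using \<open>c \<in> carrier k\<close> by (simp only: coset M.smult_closed map_closed map_smult)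
  qed
  ultimately show "linear_map k ?Q ?Q' ?h"
    using ZZ by (intro linear_map.intro linear_map_axioms.intro M.module_subquotient N.module_subquotient Z B Z' B')
      (auto simp: carrier Zc coset(7))
qed

section \<open>Hochschild cohomology\<close>

lemma tuples_hd: "xs \<in> tuples A (Suc n) \<Longrightarrow> hd xs \<in> carrier A"
  and tuples_tl: "xs \<in> tuples A (Suc n) \<Longrightarrow> tl xs \<in> tuples A n"
  by (cases xs; auto simp: tuples_def)+

lemma tuples_last: "xs \<in> tuples A (Suc n) \<Longrightarrow> last xs \<in> carrier A"
  and tuples_butlast: "xs \<in> tuples A (Suc n) \<Longrightarrow> butlast xs \<in> tuples A n"
  by (cases xs rule: rev_cases; auto simp: tuples_def)+

lemma (in monoid) tuples_inner_face:
  assumes "xs \<in> tuples G (Suc n)" "i < n"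
  shows "take i xs @ (xs ! i \<otimes> xs ! Suc i) # drop (Suc (Suc i)) xs \<in> tuples G n"
proof -
  have "xs ! i \<in> carrier G" "xs ! Suc i \<in> carrier G"
    using assms by (auto simp: tuples_def subset_code)
  then show ?thesis
    using assms by (auto simp: tuples_def dest: in_set_takeD in_set_dropD)
qed

lemma tuples_map: "\<phi> \<in> carrier B \<rightarrow> carrier A \<Longrightarrow> xs \<in> tuples B n \<Longrightarrow> map \<phi> xs \<in> tuples A n"
  by (auto simp: tuples_def Pi_def)

lemma tuples_list_update: "xs \<in> tuples A n \<Longrightarrow> x \<in> carrier A \<Longrightarrow> xs[i := x] \<in> tuples A n"
  using set_update_subset_insert by (fastforce simp: tuples_def)

text \<open>Weaker than a bimodule: cohomology is taken as a subquotient of the module of all functions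
  on tuples, so neither the multilinearity of \<open>d f\<close> nor \<open>d \<circ> d = 0\<close>, and hence no
  associativity of the two operations, is involved.\<close>

locale hochschild_coefficients = associative_algebra k A + M: module k M
  for k :: "('k, 'r) ring_scheme" and A :: "('k, 'a) module" and M :: "('k, 'm, 'a) bimodule" +
  assumes lact_linear: "a \<in> carrier A \<Longrightarrow> linear_map k M M (lact M a)"
    and ract_linear: "a \<in> carrier A \<Longrightarrow> linear_map k M M (\<lambda>m. ract M m a)"
begin

lemma coboundary_linear:
  "linear_map k (function_module (tuples A n) M) (function_module (tuples A (Suc n)) M) (coboundary A M n)"
proof (intro linear_map.intro linear_map_axioms.intro module_function_module M.module_axioms)
  note closed = linear_map.map_closed[OF lact_linear] linear_map.map_closed[OF ract_linear]
    tuples_hd tuples_tl tuples_last tuples_butlast tuples_inner_face PiE_const_mem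
  \<comment> \<open>The rules for \<open>finsum\<close> apply only to summands in the carrier; this
    fact discharges that condition for the inner faces.\<close>
  have closed_sum: "(\<lambda>i. [((-1) ^ Suc i :: int)] \<cdot>\<^bsub>M\<^esub>
        f (take i xs @ (xs ! i \<otimes>\<^bsub>A\<^esub> xs ! Suc i) # drop (Suc (Suc i)) xs)) \<in> {..<n} \<rightarrow> carrier M"
    if "f \<in> tuples A n \<rightarrow>\<^sub>E carrier M" "xs \<in> tuples A (Suc n)" for f xs
    using that by (auto simp: closed)
  fix f assume f: "f \<in> carrier (function_module (tuples A n) M)"
  show "coboundary A M n f \<in> carrier (function_module (tuples A (Suc n)) M)"
    using f by (auto simp: coboundary_def closed closed_sum)
  show "coboundary A M n (c \<odot>\<^bsub>function_module (tuples A n) M\<^esub> f)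
      = c \<odot>\<^bsub>function_module (tuples A (Suc n)) M\<^esub> coboundary A M n f" if "c \<in> carrier k" for c
  proof -
    \<comment> \<open>Viewed as a linear map, the scalar passes through the sum and the signs by
      \<open>map_finsum\<close> and \<open>map_add_pow\<close>.\<close>
    interpret c: linear_map k M M "\<lambda>m. c \<odot>\<^bsub>M\<^esub> m"
      using that by (rule M.linear_map_smult)
    show ?thesis
      using f that
      by (auto simp: coboundary_def closed closed_sum c.map_finsum c.map_add_pow c.map_add
          linear_map.map_smult[OF lact_linear] linear_map.map_smult[OF ract_linear]
          intro!: restrict_ext cong: M.finsum_cong)
  qed
  show "coboundary A M n (f \<oplus>\<^bsub>function_module (tuples A n) M\<^esub> g)
      = coboundary A M n f \<oplus>\<^bsub>function_module (tuples A (Suc n)) M\<^esub> coboundary A M n g"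
    if "g \<in> carrier (function_module (tuples A n) M)" for g
    using f that
    by (auto simp: coboundary_def closed closed_sum M.finsum_addf M.add.int_pow_distrib M.a_ac
        linear_map.map_add[OF lact_linear] linear_map.map_add[OF ract_linear]
        intro!: restrict_ext cong: M.finsum_cong)
qed

text \<open>A scalar multiple of a multilinear function is multilinear because two scalars can be
  interchanged, \<open>k\<close> being commutative.\<close>

lemma cochain_carrier_submodule:
  "submodule (cochain_carrier k A M n) k (function_module (tuples A n) M)"
proof -
  interpret F: module k "function_module (tuples A n) M"
    by (rule module_function_module) (rule M.module_axioms)
  show ?thesis
    by (rule F.submodule_of_closed)
      (auto simp: cochain_carrier_def tuples_list_update M.a_ac M.smult_r_distr R.m_comm
        PiE_const_mem simp flip: M.smult_assoc1)
qed

lemma cocycles_submodule: "submodule (cocycles k A M n) k (function_module (tuples A n) M)"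
proof -
  interpret F: module k "function_module (tuples A n) M"
    by (rule module_function_module) (rule M.module_axioms)
  \<comment> \<open>The differential is linear on all functions, so cocycles are its kernel there,
    cut down to the multilinear functions.\<close>
  have "cocycles k A M n = cochain_carrier k A M n \<inter>
      {f \<in> carrier (function_module (tuples A n) M).
        coboundary A M n f = \<zero>\<^bsub>function_module (tuples A (Suc n)) M\<^esub>}"
    by (auto simp: cocycles_def cochains_def cochain_carrier_def)
  then show ?thesis
    using F.submodule_Int[OF cochain_carrier_submodule linear_map.submodule_kernel[OF coboundary_linear]]
    by simp
qed

lemma coboundaries_submodule: "submodule (coboundaries k A M n) k (function_module (tuples A n) M)"
proof (cases n)
  case 0
  then show ?thesis
    using module.submodule_zero[OF module_function_module[OF M.module_axioms]]
    by (simp add: cochains_def)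
next
  case (Suc m)
  then show ?thesis
    using linear_map.submodule_image[OF coboundary_linear cochain_carrier_submodule]
    by (simp add: cochains_def)
qed

lemma cohomology_class_eq:
  "cohomology_class k A M n = (\<lambda>z. coboundaries k A M n +>\<^bsub>function_module (tuples A n) M\<^esub> z)"
  by (simp add: fun_eq_iff cohomology_class_def a_r_coset_def' cochains_def)

text \<open>The modules \<open>cochains\<close> and \<open>function_module\<close> differ in their
  carriers but have the same operations, and cosets, sums of cosets and scalar multiples of cosets
  are formed from the operations alone.\<close>

lemma hochschild_eq_subquotient:
  "hochschild k A M n =
    subquotient (function_module (tuples A n) M) (cocycles k A M n) (coboundaries k A M n)"
proof -
  have "set_add (cochains k A M n) = set_add (function_module (tuples A n) M)"
    by (intro ext) (simp only: set_add_def' cochains_def function_module_simps ring.simps)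
  moreover have "smult (cochains k A M n) = smult (function_module (tuples A n) M)"
    by (intro ext) (simp only: cochains_def function_module_simps module.simps)
  ultimately show ?thesis
    by (simp only: hochschild_def subquotient_def cohomology_class_eq)
qed

lemma module_hochschild: "module k (hochschild k A M n)"
  unfolding hochschild_eq_subquotient
  by (intro module.module_subquotient module_function_module M.module_axioms
      cocycles_submodule coboundaries_submodule)

lemma hochschild_carrierE:
  assumes "X \<in> carrier (hochschild k A M n)"
  obtains z where "z \<in> cocycles k A M n" "X = cohomology_class k A M n z"
  using assms by (auto simp: hochschild_def)

end

section \<open>Cochain maps induced by an algebra map and a change of coefficients\<close>

definition cochain_pullback ::
    "('k, 'b) module \<Rightarrow> ('b \<Rightarrow> 'a) \<Rightarrow> ('m \<Rightarrow> 'n) \<Rightarrow> nat \<Rightarrow> ('a list \<Rightarrow> 'm) \<Rightarrow> ('b list \<Rightarrow> 'n)"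
  where "cochain_pullback B \<phi> h n f = (\<lambda>xs\<in>tuples B n. h (f (map \<phi> xs)))"

text \<open>Covers both middle arrows of the composite at once: restriction along \<phi> is the case
  where \<open>h\<close> is the identity, change of coefficients the case where \<phi> is the
  identity. The two action laws say that \<open>h\<close> is a morphism of
  \<open>B\<close>-bimodules from \<open>M\<close>, restricted along \<phi>, to
  \<open>N\<close>.\<close>

locale cochain_map =
  A: hochschild_coefficients k A M + B: hochschild_coefficients k B N +
  \<phi>: linear_map k B A \<phi> + h: linear_map k M N h
  for k :: "('k, 'r) ring_scheme" and A :: "('k, 'a) module" and M :: "('k, 'm, 'a) bimodule"
    and B :: "('k, 'b) module" and N :: "('k, 'n, 'b) bimodule"
    and \<phi> :: "'b \<Rightarrow> 'a" and h :: "'m \<Rightarrow> 'n" +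
  assumes map_mult: "\<lbrakk>x \<in> carrier B; y \<in> carrier B\<rbrakk> \<Longrightarrow> \<phi> (x \<otimes>\<^bsub>B\<^esub> y) = \<phi> x \<otimes>\<^bsub>A\<^esub> \<phi> y"
    and map_lact: "\<lbrakk>b \<in> carrier B; m \<in> carrier M\<rbrakk> \<Longrightarrow> h (lact M (\<phi> b) m) = lact N b (h m)"
    and map_ract: "\<lbrakk>b \<in> carrier B; m \<in> carrier M\<rbrakk> \<Longrightarrow> h (ract M m (\<phi> b)) = ract N (h m) b"
begin

lemma map_tuples: "xs \<in> tuples B n \<Longrightarrow> map \<phi> xs \<in> tuples A n"
  using tuples_map \<phi>.map_closed by blast

lemma pullback_linear:
  "linear_map k (function_module (tuples A n) M) (function_module (tuples B n) N) (cochain_pullback B \<phi> h n)"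
  by (intro linear_map.intro linear_map_axioms.intro module_function_module A.M.module_axioms B.M.module_axioms)
    (auto simp: cochain_pullback_def map_tuples h.map_closed h.map_add h.map_smult PiE_const_mem
      intro!: restrict_ext)

lemma pullback_cochain_carrier:
  "cochain_pullback B \<phi> h n ` cochain_carrier k A M n \<subseteq> cochain_carrier k B N n"
  by (auto simp: cochain_carrier_def cochain_pullback_def map_tuples tuples_list_update map_update
      h.map_closed h.map_add h.map_smult \<phi>.map_closed \<phi>.map_add \<phi>.map_smult PiE_const_mem)

text \<open>The faces match one by one: the inner ones because \<phi> is multiplicative, the two
  outer ones because \<open>h\<close> respects the left and right actions. Additivity of
  \<open>h\<close> then takes care of the signed sum.\<close>

lemma coboundary_pullback:
  assumes f: "f \<in> tuples A n \<rightarrow>\<^sub>E carrier M"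
  shows "coboundary B N n (cochain_pullback B \<phi> h n f)
    = cochain_pullback B \<phi> h (Suc n) (coboundary A M n f)"
proof -
  have "coboundary B N n (cochain_pullback B \<phi> h n f) xs
      = cochain_pullback B \<phi> h (Suc n) (coboundary A M n f) xs" if xs: "xs \<in> tuples B (Suc n)" for xs
  proof -
    let ?ys = "map \<phi> xs"
    let ?A = "\<lambda>i. take i ?ys @ (?ys ! i \<otimes>\<^bsub>A\<^esub> ?ys ! Suc i) # drop (Suc (Suc i)) ?ys"
    let ?B = "\<lambda>i. take i xs @ (xs ! i \<otimes>\<^bsub>B\<^esub> xs ! Suc i) # drop (Suc (Suc i)) xs"
    have ys: "?ys \<in> tuples A (Suc n)"
      using xs by (rule map_tuples)
    have len: "length xs = Suc n" "xs \<noteq> []" and nth: "\<And>i. i < Suc n \<Longrightarrow> xs ! i \<in> carrier B"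
      using xs by (auto simp: tuples_def subset_code)
    have face: "map \<phi> (?B i) = ?A i" if "i < n" for i
      using that len nth by (simp add: take_map drop_map map_mult)
    have closed: "f (tl ?ys) \<in> carrier M" "f (butlast ?ys) \<in> carrier M" "\<And>i. i < n \<Longrightarrow> f (?A i) \<in> carrier M"
      using ys tuples_tl tuples_butlast A.tuples_inner_face by (blast intro: PiE_const_mem[OF f])+
    have lin: "linear_map k M M (lact M (hd ?ys))" "linear_map k M M (\<lambda>m. ract M m (last ?ys))"
      using ys by (auto intro!: A.lact_linear A.ract_linear tuples_hd tuples_last)
    have h: "h (lact M (hd ?ys) (f (tl ?ys))) = lact N (hd xs) (h (f (tl ?ys)))"
      "h (ract M (f (butlast ?ys)) (last ?ys)) = ract N (h (f (butlast ?ys))) (last xs)"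
      using xs len closed by (simp_all add: hd_map last_map map_lact map_ract tuples_hd tuples_last)
    have sums: "(\<lambda>i. [((-1) ^ Suc i :: int)] \<cdot>\<^bsub>M\<^esub> f (?A i)) \<in> {..<n} \<rightarrow> carrier M"
      using closed by auto
    \<comment> \<open>Both sides are brought to this common form, with \<open>h\<close> applied to
      each value of \<open>f\<close> and all faces taken in \<open>A\<close>.\<close>
    have "h (coboundary A M n f ?ys) =
      lact N (hd xs) (h (f (tl ?ys))) \<oplus>\<^bsub>N\<^esub>
      (\<Oplus>\<^bsub>N\<^esub>i\<in>{..<n}. [((-1) ^ Suc i :: int)] \<cdot>\<^bsub>N\<^esub> h (f (?A i))) \<oplus>\<^bsub>N\<^esub>
      [((-1) ^ Suc n :: int)] \<cdot>\<^bsub>N\<^esub> ract N (h (f (butlast ?ys))) (last xs)"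
      using ys closed sums lin[THEN linear_map.map_closed]
      by (simp add: coboundary_def h.map_add h.map_finsum h.map_add_pow h h.map_closed
          A.M.finsum_closed cong: B.M.finsum_cong)
    moreover have "coboundary B N n (cochain_pullback B \<phi> h n f) xs =
      lact N (hd xs) (h (f (tl ?ys))) \<oplus>\<^bsub>N\<^esub>
      (\<Oplus>\<^bsub>N\<^esub>i\<in>{..<n}. [((-1) ^ Suc i :: int)] \<cdot>\<^bsub>N\<^esub> h (f (?A i))) \<oplus>\<^bsub>N\<^esub>
      [((-1) ^ Suc n :: int)] \<cdot>\<^bsub>N\<^esub> ract N (h (f (butlast ?ys))) (last xs)"
    proof -
      have "(\<Oplus>\<^bsub>N\<^esub>i\<in>{..<n}. [((-1) ^ Suc i :: int)] \<cdot>\<^bsub>N\<^esub> cochain_pullback B \<phi> h n f (?B i))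
        = (\<Oplus>\<^bsub>N\<^esub>i\<in>{..<n}. [((-1) ^ Suc i :: int)] \<cdot>\<^bsub>N\<^esub> h (f (?A i)))"
      proof (rule B.M.finsum_cong')
        fix i assume "i \<in> {..<n}"
        \<comment> \<open>The pullback is restricted to tuples over \<open>B\<close>, so the face
          \<open>?B i\<close> must first be recognized as such a tuple.\<close>
        then have "cochain_pullback B \<phi> h n f (?B i) = h (f (?A i))"
          using B.tuples_inner_face[OF xs] face unfolding cochain_pullback_def by simp
        then show "[((-1) ^ Suc i :: int)] \<cdot>\<^bsub>N\<^esub> cochain_pullback B \<phi> h n f (?B i)
          = [((-1) ^ Suc i :: int)] \<cdot>\<^bsub>N\<^esub> h (f (?A i))"
          by simp
      qed (use closed in \<open>auto simp: h.map_closed\<close>)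
      then show ?thesis
        using xs by (simp add: coboundary_def cochain_pullback_def tuples_tl tuples_butlast map_tl map_butlast)
    qed
    ultimately show ?thesis
      using xs by (simp add: cochain_pullback_def)
  qed
  then show ?thesis
    by (intro extensionalityI[of _ "tuples B (Suc n)"]) (auto simp: coboundary_def cochain_pullback_def)
qed

lemma pullback_cocycles: "cochain_pullback B \<phi> h n ` cocycles k A M n \<subseteq> cocycles k B N n"
proof (intro image_subsetI)
  fix z assume "z \<in> cocycles k A M n"
  then have z: "z \<in> cochain_carrier k A M n" "coboundary A M n z = \<zero>\<^bsub>function_module (tuples A (Suc n)) M\<^esub>"
    by (auto simp: cocycles_def cochains_def)
  then have "coboundary B N n (cochain_pullback B \<phi> h n z) = \<zero>\<^bsub>function_module (tuples B (Suc n)) N\<^esub>"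
    using coboundary_pullback[of z n] linear_map.map_zero[OF pullback_linear]
    by (simp add: cochain_carrier_def del: function_module_simps(2))
  then show "cochain_pullback B \<phi> h n z \<in> cocycles k B N n"
    using pullback_cochain_carrier z by (auto simp: cocycles_def cochains_def)
qed

lemma pullback_coboundaries:
  "cochain_pullback B \<phi> h n ` coboundaries k A M n \<subseteq> coboundaries k B N n"
proof (cases n)
  case 0
  then show ?thesis
    using linear_map.map_zero[OF pullback_linear, of 0] by (simp add: cochains_def)
next
  case (Suc m)
  then show ?thesis
    using pullback_cochain_carrier[of m]
    by (auto simp: cochains_def cochain_carrier_def image_subset_iff simp flip: coboundary_pullback
        intro!: imageI)
qed

lemma cohomology_map_hom:
  "cohomology_map k A M B N n (cochain_pullback B \<phi> h n)
    \<in> module_homs k (hochschild k A M n) (hochschild k B N n)"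
  unfolding cohomology_map_def A.hochschild_eq_subquotient B.hochschild_eq_subquotient B.cohomology_class_eq
  by (intro linear_map.subquotient_map[OF pullback_linear] A.cocycles_submodule A.coboundaries_submodule
      B.cocycles_submodule B.coboundaries_submodule pullback_cocycles pullback_coboundaries)

text \<open>Evaluation on a representing cocycle, which reduces identities between maps on
  cohomology to identities between cochains.\<close>

lemma cohomology_map_class:
  assumes "z \<in> cocycles k A M n"
  shows "cohomology_map k A M B N n (cochain_pullback B \<phi> h n) (cohomology_class k A M n z)
    = cohomology_class k B N n (cochain_pullback B \<phi> h n z)"
proof -
  have "cohomology_class k A M n z \<in> carrier (hochschild k A M n)"
    using assms by (simp add: hochschild_def)
  moreover have "z \<in> carrier (function_module (tuples A n) M)"
    using assms by (simp add: cocycles_def cochains_def cochain_carrier_def)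
  ultimately show ?thesis
    using linear_map.UN_coset_eq[OF pullback_linear A.coboundaries_submodule B.coboundaries_submodule
        pullback_coboundaries]
    by (simp add: cohomology_map_def A.cohomology_class_eq B.cohomology_class_eq)
qed

end

section \<open>Dual coefficients\<close>

lemma dual_op_bimodule_simps:
  "carrier (dual_op_bimodule k A) = dual_carrier k A"
  "f \<oplus>\<^bsub>dual_op_bimodule k A\<^esub> g = (\<lambda>x\<in>carrier A. f x \<oplus>\<^bsub>k\<^esub> g x)"
  "c \<odot>\<^bsub>dual_op_bimodule k A\<^esub> f = (\<lambda>x\<in>carrier A. c \<otimes>\<^bsub>k\<^esub> f x)"
  "lact (dual_op_bimodule k A) a f = (\<lambda>x\<in>carrier A. f (x \<otimes>\<^bsub>A\<^esub> a))"
  "ract (dual_op_bimodule k A) f a = (\<lambda>x\<in>carrier A. f (a \<otimes>\<^bsub>A\<^esub> x))"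
  by (simp_all add: dual_op_bimodule_def)

text \<open>Linear functionals form a submodule of all functions from \<open>A\<close> to
  \<open>scalar_module k\<close>; \<open>module_cong\<close> transfers the structure to the record
  that also carries the two actions.\<close>

lemma module_dual_op_bimodule:
  fixes A :: "('k, 'a) module"
  assumes "associative_algebra k A"
  shows "module k (dual_op_bimodule k A)"
proof -
  interpret A: associative_algebra k A by fact
  let ?F = "function_module (carrier A) (scalar_module k)"
  interpret F: module k ?F
    by (intro module_function_module module_scalar_module A.R.cring_axioms)
  have "submodule (dual_carrier k A) k ?F"
    by (rule F.submodule_of_closed)
      (auto simp: dual_carrier_def scalar_module_def PiE_const_mem A.R.a_ac A.R.r_distr A.R.m_lcomm)
  then have "module k (?F\<lparr>carrier := dual_carrier k A\<rparr>)"
    by (rule submodule.submodule_is_module) (rule F.module_axioms)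
  then show ?thesis
    by (rule module_cong) (simp_all add: dual_op_bimodule_def function_module_def scalar_module_def)
qed

lemma hochschild_coefficients_dual:
  fixes A :: "('k, 'a) module"
  assumes "associative_algebra k A"
  shows "hochschild_coefficients k A (dual_op_bimodule k A)"
proof -
  interpret A: associative_algebra k A by fact
  show ?thesis
    by (intro hochschild_coefficients.intro hochschild_coefficients_axioms.intro linear_map.intro
        linear_map_axioms.intro A.associative_algebra_axioms module_dual_op_bimodule)
      (auto simp: dual_op_bimodule_simps dual_carrier_def PiE_const_mem A.l_distr A.r_distr
        A.smult_mult_left A.smult_mult_right intro!: restrict_ext)
qed

lemma hochschild_coefficients_regular:
  fixes A :: "('k, 'a) module"
  assumes "associative_algebra k A"
  shows "hochschild_coefficients k A (regular_bimodule A)"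
proof -
  interpret A: associative_algebra k A by fact
  have "module k (regular_bimodule A)"
    using A.module_axioms by (rule module_cong) (simp_all add: regular_bimodule_def)
  then show ?thesis
    by (intro hochschild_coefficients.intro hochschild_coefficients_axioms.intro linear_map.intro
        linear_map_axioms.intro A.associative_algebra_axioms)
      (auto simp: regular_bimodule_def A.l_distr A.r_distr A.smult_mult_left A.smult_mult_right
        A.smult_r_distr)
qed

lemma (in hochschild_coefficients) hochschild_coefficients_restrict:
  assumes "associative_algebra k B" "\<phi> \<in> carrier B \<rightarrow> carrier A"
  shows "hochschild_coefficients k B (restrict_bimodule \<phi> M)"
proof -
  have M: "module k (restrict_bimodule \<phi> M)"
    using M.module_axioms by (rule module_cong) (simp_all add: restrict_bimodule_def)
  have "linear_map k (restrict_bimodule \<phi> M) (restrict_bimodule \<phi> M) h" if "linear_map k M M h" for h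
    using that M by (simp add: linear_map_def linear_map_axioms_def restrict_bimodule_def)
  then show ?thesis
    using assms M lact_linear ract_linear
    by (intro hochschild_coefficients.intro hochschild_coefficients_axioms.intro)
      (auto simp: restrict_bimodule_def)
qed

section \<open>Action of an algebra homomorphism on cohomology with dual coefficients\<close>

definition dual_cohomology_map ::
    "('k, 'r) ring_scheme \<Rightarrow> ('k, 'b) module \<Rightarrow> ('k, 'a) module \<Rightarrow> ('b \<Rightarrow> 'a) \<Rightarrow>
      nat \<Rightarrow> ('a list \<Rightarrow> 'a \<Rightarrow> 'k) set \<Rightarrow> ('b list \<Rightarrow> 'b \<Rightarrow> 'k) set"
  where "dual_cohomology_map k B A \<phi> n =
    compose (carrier (hochschild k A (dual_op_bimodule k A) n))
      (coefficient_map k B (restrict_bimodule \<phi> (dual_op_bimodule k A)) (dual_op_bimodule k B)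
        (dual_map B \<phi>) n)
      (restriction_map k A B \<phi> (dual_op_bimodule k A) n)"

locale associative_algebra_hom =
  A: associative_algebra k A + B: associative_algebra k B
  for k :: "('k, 'r) ring_scheme" and B :: "('k, 'b) module" and A :: "('k, 'a) module"
    and \<phi> :: "'b \<Rightarrow> 'a" +
  assumes hom: "\<phi> \<in> algebra_homs k B A"
begin

lemma hom_closed: "x \<in> carrier B \<Longrightarrow> \<phi> x \<in> carrier A"
  and hom_add: "x \<in> carrier B \<Longrightarrow> y \<in> carrier B \<Longrightarrow> \<phi> (x \<oplus>\<^bsub>B\<^esub> y) = \<phi> x \<oplus>\<^bsub>A\<^esub> \<phi> y"
  and hom_mult: "x \<in> carrier B \<Longrightarrow> y \<in> carrier B \<Longrightarrow> \<phi> (x \<otimes>\<^bsub>B\<^esub> y) = \<phi> x \<otimes>\<^bsub>A\<^esub> \<phi> y"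
  and hom_smult: "c \<in> carrier k \<Longrightarrow> x \<in> carrier B \<Longrightarrow> \<phi> (c \<odot>\<^bsub>B\<^esub> x) = c \<odot>\<^bsub>A\<^esub> \<phi> x"
  using hom by (auto simp: algebra_homs_def module_homs_def ring_hom_def)

lemma hom_linear: "linear_map k B A \<phi>"
  by (intro linear_map.intro linear_map_axioms.intro A.module_axioms B.module_axioms)
    (simp_all add: hom_closed hom_add hom_smult)

abbreviation "dual_A \<equiv> dual_op_bimodule k A"
abbreviation "dual_B \<equiv> dual_op_bimodule k B"
abbreviation "restricted_dual_A \<equiv> restrict_bimodule \<phi> dual_A"

lemma coefficients_dual_A: "hochschild_coefficients k A dual_A"
  and coefficients_dual_B: "hochschild_coefficients k B dual_B"
  by (intro hochschild_coefficients_dual A.associative_algebra_axioms B.associative_algebra_axioms)+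

lemma coefficients_restricted_dual_A: "hochschild_coefficients k B restricted_dual_A"
  by (rule hochschild_coefficients.hochschild_coefficients_restrict[OF coefficients_dual_A])
    (auto intro: B.associative_algebra_axioms hom_closed)

lemma restricted_dual_simps:
  "carrier restricted_dual_A = dual_carrier k A"
  "f \<oplus>\<^bsub>restricted_dual_A\<^esub> g = (\<lambda>x\<in>carrier A. f x \<oplus>\<^bsub>k\<^esub> g x)"
  "c \<odot>\<^bsub>restricted_dual_A\<^esub> f = (\<lambda>x\<in>carrier A. c \<otimes>\<^bsub>k\<^esub> f x)"
  "lact restricted_dual_A b f = (\<lambda>x\<in>carrier A. f (x \<otimes>\<^bsub>A\<^esub> \<phi> b))"
  "ract restricted_dual_A f b = (\<lambda>x\<in>carrier A. f (\<phi> b \<otimes>\<^bsub>A\<^esub> x))"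
  by (simp_all add: restrict_bimodule_def dual_op_bimodule_simps)

lemma cochain_map_restriction: "cochain_map k A dual_A B restricted_dual_A \<phi> (\<lambda>x. x)"
proof (intro cochain_map.intro cochain_map_axioms.intro coefficients_dual_A
    coefficients_restricted_dual_A hom_linear linear_map.intro linear_map_axioms.intro
    module_dual_op_bimodule A.associative_algebra_axioms)
  show "module k restricted_dual_A"
    using coefficients_restricted_dual_A by (simp add: hochschild_coefficients_def)
qed (simp_all add: restricted_dual_simps dual_op_bimodule_simps hom_mult)

text \<open>Precomposition with \<phi> respects the actions because \<phi> is multiplicative: for
  the left action both sides send \<open>x\<close> to \<open>f\<close> at the product of
  \<open>\<phi> x\<close> and \<open>\<phi> b\<close>, for the right action at the product in the
  other order.\<close>

lemma cochain_map_coefficients: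
  "cochain_map k B restricted_dual_A B dual_B (\<lambda>x. x) (dual_map B \<phi>)"
proof (intro cochain_map.intro cochain_map_axioms.intro coefficients_dual_B
    coefficients_restricted_dual_A linear_map.intro linear_map_axioms.intro
    module_dual_op_bimodule B.associative_algebra_axioms B.module_axioms)
  show "module k restricted_dual_A"
    using coefficients_restricted_dual_A by (simp add: hochschild_coefficients_def)
qed (auto simp: restricted_dual_simps dual_op_bimodule_simps hom_closed hom_add hom_mult hom_smult
    dual_map_def dual_carrier_def PiE_const_mem intro!: restrict_ext)

lemma restriction_map_eq:
  "restriction_map k A B \<phi> dual_A n =
    cohomology_map k A dual_A B restricted_dual_A n (cochain_pullback B \<phi> (\<lambda>x. x) n)"
  by (simp add: restriction_map_def cochain_pullback_def[abs_def])

lemma coefficient_map_eq: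
  "coefficient_map k B restricted_dual_A dual_B (dual_map B \<phi>) n =
    cohomology_map k B restricted_dual_A B dual_B n (cochain_pullback B (\<lambda>x. x) (dual_map B \<phi>) n)"
  by (simp add: coefficient_map_def cochain_pullback_def[abs_def])

lemma dual_cohomology_map_hom:
  "dual_cohomology_map k B A \<phi> n \<in> module_homs k (hochschild k A dual_A n) (hochschild k B dual_B n)"
  unfolding dual_cohomology_map_def restriction_map_eq coefficient_map_eq
  using cochain_map.cohomology_map_hom[OF cochain_map_restriction]
    cochain_map.cohomology_map_hom[OF cochain_map_coefficients]
    hochschild_coefficients.module_hochschild[OF coefficients_dual_A]
  by (rule module_homs_compose)

lemma pullback_dual_cocycles:
  assumes "z \<in> cocycles k A dual_A n"
  shows "cochain_pullback B \<phi> (dual_map B \<phi>) n z \<in> cocycles k B dual_B n"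
    and "dual_cohomology_map k B A \<phi> n (cohomology_class k A dual_A n z)
      = cohomology_class k B dual_B n (cochain_pullback B \<phi> (dual_map B \<phi>) n z)"
proof -
  let ?w = "cochain_pullback B \<phi> (\<lambda>x. x) n z"
  have w: "?w \<in> cocycles k B restricted_dual_A n"
    using cochain_map.pullback_cocycles[OF cochain_map_restriction] assms by blast
  \<comment> \<open>Restriction followed by change of coefficients is a single pullback that does
    both, so the composite has one formula on cocycles.\<close>
  have eq: "cochain_pullback B (\<lambda>x. x) (dual_map B \<phi>) n ?w = cochain_pullback B \<phi> (dual_map B \<phi>) n z"
    by (auto simp: cochain_pullback_def)
  show "cochain_pullback B \<phi> (dual_map B \<phi>) n z \<in> cocycles k B dual_B n"
    using cochain_map.pullback_cocycles[OF cochain_map_coefficients] w eq by force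
  show "dual_cohomology_map k B A \<phi> n (cohomology_class k A dual_A n z)
      = cohomology_class k B dual_B n (cochain_pullback B \<phi> (dual_map B \<phi>) n z)"
    using assms w
    by (simp add: dual_cohomology_map_def compose_def restriction_map_eq coefficient_map_eq hochschild_def
        cochain_map.cohomology_map_class[OF cochain_map_restriction]
        cochain_map.cohomology_map_class[OF cochain_map_coefficients] eq)
qed

end

section \<open>Identity and composition laws for dual coefficients\<close>

lemma algebra_homs_id:
  fixes A :: "('k, 'a) module"
  assumes "associative_algebra k A"
  shows "(\<lambda>x\<in>carrier A. x) \<in> algebra_homs k A A"
proof -
  interpret A: associative_algebra k A by fact
  show ?thesis
    by (auto simp: algebra_homs_def module_homs_def ring_hom_def)
qed

lemma algebra_homs_compose:
  fixes A :: "('k, 'a) module" and B :: "('k, 'b) module" and C :: "('k, 'c) module"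
  assumes "associative_algebra k C" and f: "f \<in> algebra_homs k C B" and g: "g \<in> algebra_homs k B A"
  shows "compose (carrier C) g f \<in> algebra_homs k C A"
proof -
  interpret C: associative_algebra k C by fact
  have "compose (carrier C) g f \<in> module_homs k C A"
    using f g module_homs_compose[OF _ _ C.module_axioms] by (auto simp: algebra_homs_def)
  moreover have "compose (carrier C) g f \<in> ring_hom C A"
    using f g by (auto simp: algebra_homs_def ring_hom_def compose_def Pi_def)
  ultimately show ?thesis
    by (simp add: algebra_homs_def)
qed

lemma dual_cohomology_map_id:
  fixes A :: "('k, 'a) module"
  assumes A: "associative_algebra k A" and X: "X \<in> carrier (hochschild k A (dual_op_bimodule k A) n)"
  shows "dual_cohomology_map k A A (\<lambda>x\<in>carrier A. x) n X = X"
proof -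
  interpret associative_algebra_hom k A A "\<lambda>x\<in>carrier A. x"
    by (intro associative_algebra_hom.intro associative_algebra_hom_axioms.intro A algebra_homs_id)
  obtain z where z: "z \<in> cocycles k A dual_A n" "X = cohomology_class k A dual_A n z"
    using X hochschild_coefficients.hochschild_carrierE[OF coefficients_dual_A] by blast
  then have "z \<in> tuples A n \<rightarrow>\<^sub>E dual_carrier k A"
    by (simp add: cocycles_def cochains_def cochain_carrier_def dual_op_bimodule_simps)
  moreover have "map (\<lambda>x\<in>carrier A. x) xs = xs" if "xs \<in> tuples A n" for xs
    using that by (intro map_idI) (auto simp: tuples_def)
  \<comment> \<open>Elements of the dual are extensional, so restricting \<open>f\<close> to the
    carrier again does not change it.\<close>
  moreover have "dual_map A (\<lambda>x\<in>carrier A. x) f = f" if "f \<in> dual_carrier k A" for f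
    using that by (intro extensionalityI[of _ "carrier A"]) (auto simp: dual_carrier_def dual_map_def PiE_iff)
  ultimately have "cochain_pullback A (\<lambda>x\<in>carrier A. x) (dual_map A (\<lambda>x\<in>carrier A. x)) n z = z"
    by (intro extensionalityI[of _ "tuples A n"]) (auto simp: cochain_pullback_def PiE_iff)
  then show ?thesis
    using pullback_dual_cocycles(2)[OF z(1)] z(2) by simp
qed

lemma dual_cohomology_map_compose:
  fixes A :: "('k, 'a) module" and B :: "('k, 'b) module" and C :: "('k, 'c) module"
  assumes algebras: "associative_algebra k A" "associative_algebra k B" "associative_algebra k C"
    and f: "f \<in> algebra_homs k C B" and g: "g \<in> algebra_homs k B A"
    and X: "X \<in> carrier (hochschild k A (dual_op_bimodule k A) n)"
  shows "dual_cohomology_map k C A (compose (carrier C) g f) n X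
    = dual_cohomology_map k C B f n (dual_cohomology_map k B A g n X)"
proof -
  interpret f: associative_algebra_hom k C B f
    by (intro associative_algebra_hom.intro associative_algebra_hom_axioms.intro algebras f)
  interpret g: associative_algebra_hom k B A g
    by (intro associative_algebra_hom.intro associative_algebra_hom_axioms.intro algebras g)
  interpret gf: associative_algebra_hom k C A "compose (carrier C) g f"
    by (intro associative_algebra_hom.intro associative_algebra_hom_axioms.intro algebras
        algebra_homs_compose[OF _ f g])
  obtain z where z: "z \<in> cocycles k A g.dual_A n" "X = cohomology_class k A g.dual_A n z"
    using X hochschild_coefficients.hochschild_carrierE[OF g.coefficients_dual_A] by blast
  have map_compose: "map (compose (carrier C) g f) xs = map (g \<circ> f) xs" if "xs \<in> tuples C n" for xs
    using that by (auto simp: tuples_def compose_def)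
  \<comment> \<open>Precomposition reverses the order of \<open>f\<close> and \<open>g\<close>. The
    inner restriction to \<open>carrier B\<close> is invisible because \<open>f\<close> takes its
    values there.\<close>
  have "dual_map C (compose (carrier C) g f) u = dual_map C f (dual_map B g u)" for u
    by (auto simp: dual_map_def compose_def f.hom_closed intro!: restrict_ext)
  then have "cochain_pullback C (compose (carrier C) g f) (dual_map C (compose (carrier C) g f)) n z
    = cochain_pullback C f (dual_map C f) n (cochain_pullback B g (dual_map B g) n z)"
    using linear_map.map_closed[OF f.hom_linear] tuples_map[of f C B]
    by (auto simp: cochain_pullback_def map_compose simp del: map_eq_conv intro!: restrict_ext)
  then show ?thesis
    using z g.pullback_dual_cocycles[OF z(1)]
    by (simp add: gf.pullback_dual_cocycles f.pullback_dual_cocycles)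
qed

section \<open>The functor\<close>

lemma category_graded_module_category:
  "category (graded_module_category k :: (nat \<Rightarrow> ('k, 'm) module, nat \<Rightarrow> 'm \<Rightarrow> 'm) category)"
proof
  let ?C = "graded_module_category k :: (nat \<Rightarrow> ('k, 'm) module, nat \<Rightarrow> 'm \<Rightarrow> 'm) category"
  fix W X Y Z :: "nat \<Rightarrow> ('k, 'm) module" and f g h :: "nat \<Rightarrow> 'm \<Rightarrow> 'm"
  show "Ident ?C X \<in> Arr ?C X X" if "X \<in> Obj ?C"
    using that
    by (auto simp: graded_module_category_def graded_homs_def module_homs_id)
  show "Comp ?C X Y Z g f \<in> Arr ?C X Z" if "X \<in> Obj ?C" "f \<in> Arr ?C X Y" "g \<in> Arr ?C Y Z"
    using that by (auto simp: graded_module_category_def graded_homs_def intro: module_homs_compose)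
  show "Comp ?C X Y Y (Ident ?C Y) f = f" if "f \<in> Arr ?C X Y"
    using that
    by (auto simp: graded_module_category_def graded_homs_def module_homs_def fun_eq_iff compose_def
        PiE_iff extensional_def)
  show "Comp ?C X X Y f (Ident ?C X) = f" if "f \<in> Arr ?C X Y"
    using that
    by (auto simp: graded_module_category_def graded_homs_def module_homs_def fun_eq_iff compose_def
        PiE_iff extensional_def)
  show "Comp ?C W X Z (Comp ?C X Y Z h g) f = Comp ?C W Y Z h (Comp ?C W X Y g f)"
    if "f \<in> Arr ?C W X"
    using that
    by (auto simp: graded_module_category_def graded_homs_def module_homs_def fun_eq_iff compose_def
        PiE_iff)
qed

lemma category_quasi_self_dual_category:
  "category (quasi_self_dual_category k ::
    (('k, 'a) module \<times> ('k, 'a) self_duality, 'a \<Rightarrow> 'a) category)"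
proof
  let ?C = "quasi_self_dual_category k ::
    (('k, 'a) module \<times> ('k, 'a) self_duality, 'a \<Rightarrow> 'a) category"
  fix W X Y Z :: "('k, 'a) module \<times> ('k, 'a) self_duality" and f g h :: "'a \<Rightarrow> 'a"
  show "Ident ?C X \<in> Arr ?C X X" if "X \<in> Obj ?C"
    using that by (auto simp: quasi_self_dual_category_def quasi_self_dual_def algebra_homs_id)
  show "Comp ?C X Y Z g f \<in> Arr ?C X Z" if "X \<in> Obj ?C" "f \<in> Arr ?C X Y" "g \<in> Arr ?C Y Z"
    using that
    by (auto simp: quasi_self_dual_category_def quasi_self_dual_def intro: algebra_homs_compose)
  show "Comp ?C X Y Y (Ident ?C Y) f = f" if "f \<in> Arr ?C X Y"
    using that
    by (cases X; cases Y) (auto simp: quasi_self_dual_category_def algebra_homs_def module_homs_def fun_eq_iff compose_def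
        PiE_iff extensional_def)
  show "Comp ?C X X Y f (Ident ?C X) = f" if "f \<in> Arr ?C X Y"
    using that
    by (cases X; cases Y) (auto simp: quasi_self_dual_category_def algebra_homs_def module_homs_def fun_eq_iff compose_def
        PiE_iff extensional_def)
  show "Comp ?C W X Z (Comp ?C X Y Z h g) f = Comp ?C W Y Z h (Comp ?C W X Y g f)"
    if "f \<in> Arr ?C W X"
    using that
    by (cases W; cases X) (auto simp: quasi_self_dual_category_def algebra_homs_def module_homs_def fun_eq_iff compose_def
        PiE_iff)
qed

text \<open>Separates the two isomorphisms from the functorial middle part. Since
  \<open>dual_cohomology_map\<close> is restricted to the cohomology of \<open>A\<close> with dual
  coefficients, \<theta> has to be known to land there.\<close>

lemma self_cohomology_map_eq:
  assumes "quasi_self_dual k A \<theta>A"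
  shows "self_cohomology_map k (B, \<theta>B) (A, \<theta>A) \<phi> n =
    (\<lambda>X\<in>carrier (hochschild k A (regular_bimodule A) n).
      inv_into (carrier (hochschild k B (regular_bimodule B) n)) (\<theta>B n)
        (dual_cohomology_map k B A \<phi> n (\<theta>A n X)))"
proof -
  have "\<theta>A n X \<in> carrier (hochschild k A (dual_op_bimodule k A) n)"
    if "X \<in> carrier (hochschild k A (regular_bimodule A) n)" for X
    using assms that
    by (auto simp: quasi_self_dual_def graded_isos_def graded_homs_def module_homs_def PiE_const_mem)
  then show ?thesis
    by (auto simp: self_cohomology_map_def dual_cohomology_map_def compose_def intro!: restrict_ext)
qed

theorem mainTheorem3:
  fixes k :: "('k, 'r) ring_scheme"
  assumes "cring k"
  shows "contravariant_functor
    (quasi_self_dual_category k ::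
      (('k, 'a) module \<times> ('k, 'a) self_duality, 'a \<Rightarrow> 'a) category)
    (graded_module_category k)
    (self_cohomology k)
    (self_cohomology_map k)"
proof (intro contravariant_functor.intro contravariant_functor_axioms.intro
    category_quasi_self_dual_category category_graded_module_category)
  let ?C = "quasi_self_dual_category k ::
      (('k, 'a) module \<times> ('k, 'a) self_duality, 'a \<Rightarrow> 'a) category"
  let ?D = "graded_module_category k"
  let ?H = "\<lambda>A. hochschild k A (regular_bimodule A)"
  let ?H' = "\<lambda>A. hochschild k A (dual_op_bimodule k A)"
  have duality: "associative_algebra k A" "\<And>n. module k (?H A n)"
      "\<And>n. \<theta> n \<in> module_homs k (?H A n) (?H' A n)" "\<And>n. bij_betw (\<theta> n) (carrier (?H A n)) (carrier (?H' A n))"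
      "\<And>n X. X \<in> carrier (?H A n) \<Longrightarrow> \<theta> n X \<in> carrier (?H' A n)"
    if "quasi_self_dual k A \<theta>" for A :: "('k, 'a) module" and \<theta>
    using that hochschild_coefficients.module_hochschild[OF hochschild_coefficients_regular]
    by (auto simp: quasi_self_dual_def graded_isos_def graded_homs_def intro: bij_betwE[rule_format])
  have dual_hom: "dual_cohomology_map k B A f n \<in> module_homs k (?H' A n) (?H' B n)"
    if "quasi_self_dual k B \<theta>B" "quasi_self_dual k A \<theta>A" "f \<in> algebra_homs k B A" for A B :: "('k, 'a) module" and \<theta>A \<theta>B f n
    using that
    by (intro associative_algebra_hom.dual_cohomology_map_hom associative_algebra_hom.intro
        associative_algebra_hom_axioms.intro) (auto simp: duality)
  have dual_closed: "dual_cohomology_map k B A f n (\<theta>A n U) \<in> carrier (?H' B n)"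
    if "quasi_self_dual k B \<theta>B" "quasi_self_dual k A \<theta>A" "f \<in> algebra_homs k B A"
      "U \<in> carrier (?H A n)" for A B :: "('k, 'a) module" and \<theta>A \<theta>B f n U
    using dual_hom[OF that(1-3)] duality(5)[OF that(2,4)] by (rule module_homs_closed)
  fix X Y Z :: "('k, 'a) module \<times> ('k, 'a) self_duality" and f g
  \<comment> \<open>The letters are chosen so that the arrows run from \<open>C\<close> to
    \<open>B\<close> to \<open>A\<close>, and the induced maps from \<open>A\<close> to
    \<open>B\<close> to \<open>C\<close>.\<close>
  obtain C \<theta>C B \<theta>B A \<theta>A where XYZ: "X = (C, \<theta>C)" "Y = (B, \<theta>B)" "Z = (A, \<theta>A)"
    by (metis surj_pair)
  show "self_cohomology k X \<in> Obj ?D" if "X \<in> Obj ?C"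
    using that by (auto simp: XYZ self_cohomology_def quasi_self_dual_category_def graded_module_category_def duality)
  show "self_cohomology_map k X Y f \<in> Arr ?D (self_cohomology k Y) (self_cohomology k X)"
    if "X \<in> Obj ?C" "Y \<in> Obj ?C" "f \<in> Arr ?C X Y"
  proof -
    have C: "quasi_self_dual k C \<theta>C" and B: "quasi_self_dual k B \<theta>B" and f: "f \<in> algebra_homs k C B"
      using that by (auto simp: XYZ quasi_self_dual_category_def)
    have "self_cohomology_map k X Y f n \<in> module_homs k (?H B n) (?H C n)" for n
    proof -
      \<comment> \<open>The inverse of \<theta> is restricted to its domain here, since members of
        \<open>module_homs\<close> are extensional; the map is then a composite of three
        homomorphisms.\<close>
      have "self_cohomology_map k X Y f n =
        compose (carrier (?H B n)) (\<lambda>Y\<in>carrier (?H' C n). inv_into (carrier (?H C n)) (\<theta>C n) Y)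
          (compose (carrier (?H B n)) (dual_cohomology_map k C B f n) (\<theta>B n))"
        by (simp add: XYZ self_cohomology_map_eq[OF B] compose_def dual_closed[OF C B f] cong: restrict_cong)
      also have "\<dots> \<in> module_homs k (?H B n) (?H C n)"
        by (rule module_homs_compose[OF
              module_homs_compose[OF duality(3)[OF B] dual_hom[OF C B f] duality(2)[OF B]]
              module_homs_inv_into[OF duality(3,4,2)[OF C]] duality(2)[OF B]])
      finally show ?thesis .
    qed
    then show ?thesis
      by (simp add: XYZ graded_module_category_def graded_homs_def self_cohomology_def)
  qed
  show "self_cohomology_map k X X (Ident ?C X) = Ident ?D (self_cohomology k X)" if "X \<in> Obj ?C"
  proof -
    have C: "quasi_self_dual k C \<theta>C"
      using that by (auto simp: XYZ quasi_self_dual_category_def)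
    show ?thesis
      \<comment> \<open>The middle part is the identity on the image of \<theta>, and injectivity
        lets the chosen inverse undo \<theta>.\<close>
      using duality(5)[OF C] bij_betw_imp_inj_on[OF duality(4)[OF C]]
      by (auto simp: XYZ quasi_self_dual_category_def graded_module_category_def self_cohomology_def
          self_cohomology_map_eq[OF C] dual_cohomology_map_id[OF duality(1)[OF C]]
          intro!: ext restrict_ext)
  qed
  show "self_cohomology_map k X Z (Comp ?C X Y Z g f)
      = Comp ?D (self_cohomology k Z) (self_cohomology k Y) (self_cohomology k X)
          (self_cohomology_map k X Y f) (self_cohomology_map k Y Z g)"
    if "X \<in> Obj ?C" "Y \<in> Obj ?C" "Z \<in> Obj ?C" "f \<in> Arr ?C X Y" "g \<in> Arr ?C Y Z"
  proof -
    have C: "quasi_self_dual k C \<theta>C" and B: "quasi_self_dual k B \<theta>B" and A: "quasi_self_dual k A \<theta>A"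
      and f: "f \<in> algebra_homs k C B" and g: "g \<in> algebra_homs k B A"
      using that by (auto simp: XYZ quasi_self_dual_category_def)
    \<comment> \<open>The cancellation in the middle: surjectivity of \<open>\<theta>B\<close> makes
      \<open>inv_into\<close> a right inverse, so the two dual maps become adjacent and
      \<open>dual_cohomology_map_compose\<close> applies.\<close>
    have inverse: "inv_into (carrier (?H B n)) (\<theta>B n) U \<in> carrier (?H B n)"
      "\<theta>B n (inv_into (carrier (?H B n)) (\<theta>B n) U) = U" if "U \<in> carrier (?H' B n)" for n U
      using that duality(4)[OF B, of n] by (auto simp: bij_betw_def inv_into_into f_inv_into_f)
    show ?thesis
      by (auto simp: XYZ quasi_self_dual_category_def graded_module_category_def self_cohomology_def
          self_cohomology_map_eq[OF A] self_cohomology_map_eq[OF B] compose_def inverse duality(5)[OF A] dual_closed[OF B A g]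
          dual_cohomology_map_compose[unfolded compose_def, OF duality(1)[OF A] duality(1)[OF B] duality(1)[OF C] f g]
          intro!: ext restrict_ext)
  qed
qed

end
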